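(* Let $\mathcal H$ be a real Hilbert space, let $\mu\in\,]0,\infty[$, let $n\ge 1$ be an integer, $I=\{1,\dots,n\}$, and let $\lambda_i>0$ ($i\in I$) satisfy $\sum_{i\in I}\lambda_i=1$. For each $i\in I$ let $A_i:\mathcal H\rightrightarrows\mathcal H$ be maximally monotone, and write $\mathbf A=(A_1,\dots,A_n)$, $\boldsymbol\lambda=(\lambda_1,\dots,\lambda_n)$. Then, pointwise on $\mathcal H\times\mathcal H$, $$F_{\mu\mathcal R_\mu(\mathbf A,\boldsymbol\lambda)}\le\sum_{i\in I}\lambda_iF_{\mu A_i},\qquad\text{in particular}\qquad F_{\mathcal R_1(\mathbf A,\boldsymbol\lambda)}\le\sum_{i\in I}\lambda_iF_{A_i},$$ and $$\sum_{i\in I}\lambda_i\operatorname{dom}F_{\mu A_i}\subseteq\operatorname{dom}F_{\mu\mathcal R_\mu(\mathbf A,\boldsymbol\lambda)},\qquad\text{in particular}\qquad \sum_{i\in I}\lambda_i\operatorname{dom}F_{A_i}\subseteq\operatorname{dom}F_{\mathcal R_1(\mathbf A,\boldsymbol\lambda)}.$$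
   Context: The graph of $A:\mathcal H\rightrightarrows\mathcal H$ is $\operatorname{gra}A=\{(x,u): u\in Ax\}$ and $A^{-1}$ is the set-valued mapping with $x\in A^{-1}u\Leftrightarrow u\in Ax$. Sums and scalar multiples of sets and of set-valued mappings are (pointwise) Minkowski operations; $\mathrm{Id}$ is the identity. For $\nu\in\,]0,\infty[$ the $\boldsymbol\lambda$-weighted resolvent average of $\mathbf A$ with parameter $\nu$ is $$\mathcal R_\nu(\mathbf A,\boldsymbol\lambda)=\Big(\sum_{i\in I}\lambda_i(A_i+\nu^{-1}\mathrm{Id})^{-1}\Big)^{-1}-\nu^{-1}\mathrm{Id}.$$ The Fitzpatrick function of $A$ is $F_A:\mathcal H\times\mathcal H\to\,]-\infty,+\infty]$, $$F_A(x,v)=\sup_{(z,w)\in\operatorname{gra}A}\big(\langle w,x\rangle+\langle v,z\rangle-\langle w,z\rangle\big).$$ For a function $F$ with values in $]-\infty,+\infty]$, $\operatorname{dom}F$ is the set of points where $F<\infty$. *)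

theory Defs
  imports "HOL-Analysis.Analysis" "HOL-Library.Set_Algebras"
begin

text \<open>Set-valued mappings are functions \<^typ>\<open>'a \<Rightarrow> 'a set\<close>. Sums of subsets are the Minkowski
  sums of \<^theory>\<open>HOL-Library.Set_Algebras\<close>.\<close>

type_synonym 'a svmap = "'a \<Rightarrow> 'a set"

definition gra :: "'a svmap \<Rightarrow> ('a \<times> 'a) set" where
  "gra A = {(x, u). u \<in> A x}"

definition sv_inv :: "'a svmap \<Rightarrow> 'a svmap" where
  "sv_inv A = (\<lambda>u. {x. u \<in> A x})"

definition sv_Id :: "'a svmap" where
  "sv_Id = (\<lambda>x. {x})"

definition sv_add :: "'a::real_vector svmap \<Rightarrow> 'a svmap \<Rightarrow> 'a svmap" where
  "sv_add A B = (\<lambda>x. A x + B x)"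

definition sv_scale :: "real \<Rightarrow> 'a::real_vector svmap \<Rightarrow> 'a svmap" where
  "sv_scale c A = (\<lambda>x. (*\<^sub>R) c ` A x)"

definition sv_sum :: "('i \<Rightarrow> 'a::real_vector svmap) \<Rightarrow> 'i set \<Rightarrow> 'a svmap" where
  "sv_sum A I = (\<lambda>x. \<Sum>i\<in>I. A i x)"

definition monotone_sv :: "'a::real_inner svmap \<Rightarrow> bool" where
  "monotone_sv A \<longleftrightarrow> (\<forall>(x, u) \<in> gra A. \<forall>(y, v) \<in> gra A. inner (x - y) (u - v) \<ge> 0)"

definition maximally_monotone :: "'a::real_inner svmap \<Rightarrow> bool" where
  "maximally_monotone A \<longleftrightarrow>
     monotone_sv A \<and> (\<forall>B. monotone_sv B \<and> gra A \<subseteq> gra B \<longrightarrow> gra B = gra A)"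

definition resolvent_average ::
    "real \<Rightarrow> 'i set \<Rightarrow> ('i \<Rightarrow> 'a::real_vector svmap) \<Rightarrow> ('i \<Rightarrow> real) \<Rightarrow> 'a svmap" where
  "resolvent_average \<nu> I A w =
     sv_add
       (sv_inv (sv_sum (\<lambda>i. sv_scale (w i) (sv_inv (sv_add (A i) (sv_scale (inverse \<nu>) sv_Id)))) I))
       (sv_scale (- inverse \<nu>) sv_Id)"

text \<open>The supremum is taken in \<^typ>\<open>ereal\<close>; the value \<^term>\<open>-\<infinity>\<close> occurs only when the graph is
  empty, which a maximally monotone mapping excludes.\<close>

definition Fitzpatrick :: "'a::real_inner svmap \<Rightarrow> 'a \<times> 'a \<Rightarrow> ereal" where
  "Fitzpatrick A = (\<lambda>(x, v). SUP (z, w) \<in> gra A. ereal (inner w x + inner v z - inner w z))"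

definition dom_ereal :: "('b \<Rightarrow> ereal) \<Rightarrow> 'b set" where
  "dom_ereal F = {p. F p < \<infinity>}"

end

theory Submission
  imports Defs
begin

text \<open>Write \<open>B = \<mu> R\<^sub>\<mu>(A, w)\<close>. Unfolding the definition, \<open>(z, r)\<close> lies in the graph of \<open>B\<close>
  exactly when, for some \<open>y\<close> and some points \<open>s i\<close> with \<open>y - s i \<in> \<mu> A i (s i)\<close>, one has
  \<open>z = (\<Sum>i\<in>I. w i *\<^sub>R s i)\<close> and \<open>r = y - z\<close>; only the direction from left to right is needed
  (\<open>gra_scale_resolvent_averageE\<close>). The residual \<open>y - s i\<close> is therefore a value of \<open>\<mu> A i\<close> with the
  same \<open>y\<close> for all \<open>i\<close>.

  The expression whose supremum is the Fitzpatrick function, taken at \<open>(x, v)\<close> and at a graph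
  point of the form \<open>(s, y - s)\<close>, equals
  \<open>\<langle>y, x\<rangle> - \<langle>y, s\<rangle> + \<langle>v - x, s\<rangle> + \<parallel>s\<parallel>\<^sup>2\<close>. At the averaged argument
  \<open>(x, v) = \<Sum>i. w i *\<^sub>R p i\<close>, the first two terms are compatible with averaging. For the last two,
  put \<open>a = v - x\<close> and complete the square:
  \<open>\<langle>a, s\<rangle> + \<parallel>s\<parallel>\<^sup>2 = \<parallel>s + a/2\<parallel>\<^sup>2 - \<parallel>a\<parallel>\<^sup>2/4\<close>. Convexity of the squared norm bounds the value for
  \<open>B\<close> by the weighted sum of the values for the \<open>\<mu> A i\<close> plus a quarter of the variance of the
  differences \<open>a i = snd (p i) - fst (p i)\<close>, a constant independent of the graph point (\<open>fitz_term_average_le\<close>). If all the \<open>p i\<close>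
  coincide, this constant vanishes and the pointwise inequality follows; for general
  \<open>p i\<close> it is finite, and if each \<open>p i\<close> lies in the domain of the Fitzpatrick function of \<open>\<mu> A i\<close>, the
  weighted sum is bounded above as well, which gives the inclusion of domains. The statements about
  the parameter \<open>1\<close> are the case \<open>\<mu> = 1\<close>.\<close>

text \<open>The expression whose supremum over the points \<open>q\<close> of the graph is the Fitzpatrick function
  at \<open>p\<close>.\<close>

definition fitz_term :: "'a::real_inner \<times> 'a \<Rightarrow> 'a \<times> 'a \<Rightarrow> real" where
  "fitz_term p q = inner (snd q) (fst p) + inner (snd p) (fst q) - inner (snd q) (fst q)"

lemma Fitzpatrick_eq_SUP_fitz_term: "Fitzpatrick A p = (SUP q \<in> gra A. ereal (fitz_term p q))"
  by (simp add: Fitzpatrick_def fitz_term_def case_prod_unfold)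

lemma sv_scale_one: "sv_scale 1 A = A"
  by (simp add: sv_scale_def)

lemma gra_scale_resolvent_averageE:
  fixes A :: "'i \<Rightarrow> 'a::real_vector svmap"
  assumes "finite I" and "\<mu> \<noteq> 0"
    and "(z, r) \<in> gra (sv_scale \<mu> (resolvent_average \<mu> I A w))"
  obtains y s where "z = (\<Sum>i\<in>I. w i *\<^sub>R s i)" and "r = y - z"
    and "\<And>i. i \<in> I \<Longrightarrow> (s i, y - s i) \<in> gra (sv_scale \<mu> (A i))"
proof -
  obtain u where r: "r = \<mu> *\<^sub>R (u - inverse \<mu> *\<^sub>R z)"
    and z: "z \<in> (\<Sum>i\<in>I. (*\<^sub>R) (w i) ` {x. u \<in> A i x + {inverse \<mu> *\<^sub>R x}})"
    using assms(3)
    by (auto simp: gra_def sv_scale_def resolvent_average_def sv_add_def sv_inv_def sv_sum_def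
        sv_Id_def set_plus_def)
  from z obtain t where zt: "z = sum t I"
    and t: "\<forall>i\<in>I. t i \<in> (*\<^sub>R) (w i) ` {x. u \<in> A i x + {inverse \<mu> *\<^sub>R x}}"
    unfolding set_sum_alt[OF assms(1)] by auto
  from t have "\<forall>i\<in>I. \<exists>x. t i = w i *\<^sub>R x \<and> u - inverse \<mu> *\<^sub>R x \<in> A i x"
    by (fastforce simp: set_plus_def)
  then obtain s where s: "\<And>i. i \<in> I \<Longrightarrow> t i = w i *\<^sub>R s i \<and> u - inverse \<mu> *\<^sub>R s i \<in> A i (s i)"
    by metis
  show thesis
  proof
    show "z = (\<Sum>i\<in>I. w i *\<^sub>R s i)"
      using zt s by simp
    show "r = \<mu> *\<^sub>R u - z"
      using r assms(2) by (simp add: scaleR_diff_right)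
    fix i assume "i \<in> I"
    moreover have "\<mu> *\<^sub>R u - s i = \<mu> *\<^sub>R (u - inverse \<mu> *\<^sub>R s i)"
      using assms(2) by (simp add: scaleR_diff_right)
    ultimately show "(s i, \<mu> *\<^sub>R u - s i) \<in> gra (sv_scale \<mu> (A i))"
      using s by (auto simp: gra_def sv_scale_def)
  qed
qed

lemma inner_self_weighted_sum_le:
  fixes b :: "'i \<Rightarrow> 'a::real_inner"
  assumes "\<And>i. i \<in> I \<Longrightarrow> w i \<ge> 0" and "sum w I = 1"
  shows "inner (\<Sum>i\<in>I. w i *\<^sub>R b i) (\<Sum>i\<in>I. w i *\<^sub>R b i) \<le> (\<Sum>i\<in>I. w i * inner (b i) (b i))"
proof -
  define m where "m = (\<Sum>i\<in>I. w i *\<^sub>R b i)"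
  have "0 \<le> (\<Sum>i\<in>I. w i * inner (b i - m) (b i - m))"
    using assms(1) by (intro sum_nonneg) simp
  also have "\<dots> = (\<Sum>i\<in>I. w i * inner (b i) (b i) - 2 * inner (w i *\<^sub>R b i) m + w i * inner m m)"
    by (intro sum.cong) (auto simp: inner_diff_left inner_diff_right inner_commute algebra_simps)
  also have "\<dots> = (\<Sum>i\<in>I. w i * inner (b i) (b i)) - 2 * inner m m + sum w I * inner m m"
    unfolding sum.distrib sum_subtractf sum_distrib_left[symmetric] sum_distrib_right[symmetric]
      inner_sum_left[symmetric] m_def[symmetric] ..
  finally show ?thesis
    unfolding m_def[symmetric] assms(2) by simp
qed

text \<open>The last two terms on the right are a quarter of the variance of \<open>snd (p i) - fst (p i)\<close>.\<close>

lemma fitz_term_average_le: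
  fixes p :: "'i \<Rightarrow> 'a::real_inner \<times> 'a"
  defines "a \<equiv> \<lambda>i. snd (p i) - fst (p i)"
  assumes w: "\<And>i. i \<in> I \<Longrightarrow> w i \<ge> 0" "sum w I = 1"
    and z: "z = (\<Sum>i\<in>I. w i *\<^sub>R s i)"
  shows "fitz_term (\<Sum>i\<in>I. w i *\<^sub>R p i) (z, y - z)
      \<le> (\<Sum>i\<in>I. w i * fitz_term (p i) (s i, y - s i))
        + ((\<Sum>i\<in>I. w i * inner (a i) (a i)) / 4
           - inner (\<Sum>i\<in>I. w i *\<^sub>R a i) (\<Sum>i\<in>I. w i *\<^sub>R a i) / 4)"
proof -
  define x where "x = (\<Sum>i\<in>I. w i *\<^sub>R fst (p i))"
  define c where "c = (\<Sum>i\<in>I. w i *\<^sub>R a i)"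
  have p: "(\<Sum>i\<in>I. w i *\<^sub>R p i) = (x, x + c)"
    by (simp add: prod_eq_iff fst_sum snd_sum x_def c_def a_def sum.distrib[symmetric]
        scaleR_add_right[symmetric])
  define b where "b = (\<lambda>i. s i + (1/2) *\<^sub>R a i)"
  have zc: "z + (1/2) *\<^sub>R c = (\<Sum>i\<in>I. w i *\<^sub>R b i)"
    by (simp add: z c_def b_def scaleR_add_right sum.distrib scaleR_sum_right mult.commute)
  have square: "fitz_term (x', x' + a') (s', y - s')
      = inner y x' - inner y s' + inner (s' + (1/2) *\<^sub>R a') (s' + (1/2) *\<^sub>R a') - inner a' a' / 4"
    for x' a' s' :: 'a
    by (simp add: fitz_term_def inner_add_left inner_add_right inner_diff_left inner_diff_right
        inner_commute)
  have summand: "w i * fitz_term (p i) (s i, y - s i)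
      = inner y (w i *\<^sub>R fst (p i)) - inner y (w i *\<^sub>R s i) + w i * inner (b i) (b i)
        - w i * inner (a i) (a i) / 4" for i
  proof -
    have "p i = (fst (p i), fst (p i) + a i)"
      by (simp add: a_def)
    then have "fitz_term (p i) (s i, y - s i)
        = inner y (fst (p i)) - inner y (s i) + inner (b i) (b i) - inner (a i) (a i) / 4"
      unfolding b_def by (metis square)
    then show ?thesis
      by (simp add: right_diff_distrib distrib_left)
  qed
  have "fitz_term (x, x + c) (z, y - z)
      \<le> inner y x - inner y z + (\<Sum>i\<in>I. w i * inner (b i) (b i)) - inner c c / 4"
    unfolding square zc using inner_self_weighted_sum_le[OF w, of b] by simp
  also have "\<dots> = (\<Sum>i\<in>I. w i * fitz_term (p i) (s i, y - s i))
      + ((\<Sum>i\<in>I. w i * inner (a i) (a i)) / 4 - inner c c / 4)"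
    unfolding summand
    by (simp add: sum.distrib sum_subtractf inner_sum_right[symmetric] x_def z
        sum_divide_distrib del: inner_scaleR_right)
  finally show ?thesis
    by (simp only: p c_def)
qed

lemma Fitzpatrick_scale_resolvent_average_le:
  fixes A :: "'i \<Rightarrow> 'a::real_inner svmap"
  assumes "finite I" and "\<mu> \<noteq> 0" and w: "\<And>i. i \<in> I \<Longrightarrow> w i \<ge> 0" "sum w I = 1"
  shows "Fitzpatrick (sv_scale \<mu> (resolvent_average \<mu> I A w)) p
      \<le> (\<Sum>i\<in>I. ereal (w i) * Fitzpatrick (sv_scale \<mu> (A i)) p)"
  unfolding Fitzpatrick_eq_SUP_fitz_term[of "sv_scale \<mu> (resolvent_average \<mu> I A w)"]
proof (rule SUP_least)
  fix q assume q: "q \<in> gra (sv_scale \<mu> (resolvent_average \<mu> I A w))"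
  obtain z r where zr: "q = (z, r)" by fastforce
  obtain y s where z: "z = (\<Sum>i\<in>I. w i *\<^sub>R s i)" and r: "r = y - z"
    and s: "\<And>i. i \<in> I \<Longrightarrow> (s i, y - s i) \<in> gra (sv_scale \<mu> (A i))"
    using gra_scale_resolvent_averageE[OF assms(1,2) q[unfolded zr]] by blast
  have const: "(\<Sum>i\<in>I. w i *\<^sub>R e) = e" for e :: "'b::real_vector"
    using w(2) by (simp add: scaleR_sum_left[symmetric])
  have const': "(\<Sum>i\<in>I. w i * e) = e" for e :: real
    using w(2) by (simp add: sum_distrib_right[symmetric])
  \<comment> \<open>The variance term vanishes because all arguments equal \<open>p\<close>.\<close>
  have "fitz_term p q \<le> (\<Sum>i\<in>I. w i * fitz_term p (s i, y - s i))"
    using fitz_term_average_le[where p = "\<lambda>_. p", OF w z, of y]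
    by (simp add: zr r const const')
  then have "ereal (fitz_term p q) \<le> (\<Sum>i\<in>I. ereal (w i) * ereal (fitz_term p (s i, y - s i)))"
    by simp
  also have "\<dots> \<le> (\<Sum>i\<in>I. ereal (w i) * Fitzpatrick (sv_scale \<mu> (A i)) p)"
    unfolding Fitzpatrick_eq_SUP_fitz_term using s w(1)
    by (intro sum_mono ereal_mult_left_mono SUP_upper) auto
  finally show "ereal (fitz_term p q) \<le> \<dots>" .
qed

lemma sum_dom_Fitzpatrick_subset:
  fixes A :: "'i \<Rightarrow> 'a::real_inner svmap"
  assumes "finite I" and "\<mu> \<noteq> 0" and w: "\<And>i. i \<in> I \<Longrightarrow> w i \<ge> 0" "sum w I = 1"
  shows "(\<Sum>i\<in>I. (*\<^sub>R) (w i) ` dom_ereal (Fitzpatrick (sv_scale \<mu> (A i))))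
      \<subseteq> dom_ereal (Fitzpatrick (sv_scale \<mu> (resolvent_average \<mu> I A w)))"
proof
  fix P assume "P \<in> (\<Sum>i\<in>I. (*\<^sub>R) (w i) ` dom_ereal (Fitzpatrick (sv_scale \<mu> (A i))))"
  then obtain t where P: "P = sum t I"
    and t: "\<forall>i\<in>I. t i \<in> (*\<^sub>R) (w i) ` dom_ereal (Fitzpatrick (sv_scale \<mu> (A i)))"
    unfolding set_sum_alt[OF assms(1)] by auto
  then have "\<forall>i\<in>I. \<exists>p. t i = w i *\<^sub>R p \<and> Fitzpatrick (sv_scale \<mu> (A i)) p < \<infinity>"
    unfolding dom_ereal_def by blast
  then obtain p where p: "\<And>i. i \<in> I \<Longrightarrow> t i = w i *\<^sub>R p i"
    and fin: "\<And>i. i \<in> I \<Longrightarrow> Fitzpatrick (sv_scale \<mu> (A i)) (p i) < \<infinity>"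
    by metis
  have "\<forall>i\<in>I. \<exists>c. Fitzpatrick (sv_scale \<mu> (A i)) (p i) \<le> ereal c"
    using fin by (metis ereal_dense2 less_imp_le)
  then obtain c where c: "\<And>i. i \<in> I \<Longrightarrow> Fitzpatrick (sv_scale \<mu> (A i)) (p i) \<le> ereal (c i)"
    by metis
  have P': "P = (\<Sum>i\<in>I. w i *\<^sub>R p i)"
    using P p by simp
  define a where "a = (\<lambda>i. snd (p i) - fst (p i))"
  define K where "K = (\<Sum>i\<in>I. w i * inner (a i) (a i)) / 4
      - inner (\<Sum>i\<in>I. w i *\<^sub>R a i) (\<Sum>i\<in>I. w i *\<^sub>R a i) / 4"
  have "Fitzpatrick (sv_scale \<mu> (resolvent_average \<mu> I A w)) P \<le> ereal ((\<Sum>i\<in>I. w i * c i) + K)"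
    unfolding Fitzpatrick_eq_SUP_fitz_term
  proof (rule SUP_least)
    fix q assume q: "q \<in> gra (sv_scale \<mu> (resolvent_average \<mu> I A w))"
    obtain z r where zr: "q = (z, r)" by fastforce
    obtain y s where z: "z = (\<Sum>i\<in>I. w i *\<^sub>R s i)" and r: "r = y - z"
      and s: "\<And>i. i \<in> I \<Longrightarrow> (s i, y - s i) \<in> gra (sv_scale \<mu> (A i))"
      using gra_scale_resolvent_averageE[OF assms(1,2) q[unfolded zr]] by blast
    have le: "fitz_term (p i) (s i, y - s i) \<le> c i" if "i \<in> I" for i
    proof -
      have "ereal (fitz_term (p i) (s i, y - s i)) \<le> Fitzpatrick (sv_scale \<mu> (A i)) (p i)"
        unfolding Fitzpatrick_eq_SUP_fitz_term using s[OF that] by (rule SUP_upper)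
      also note c[OF that]
      finally show ?thesis by simp
    qed
    have "fitz_term P q \<le> (\<Sum>i\<in>I. w i * fitz_term (p i) (s i, y - s i)) + K"
      unfolding P' zr r K_def a_def using w z by (rule fitz_term_average_le)
    also have "\<dots> \<le> (\<Sum>i\<in>I. w i * c i) + K"
      using le w(1) by (intro add_right_mono sum_mono mult_left_mono) auto
    finally show "ereal (fitz_term P q) \<le> ereal ((\<Sum>i\<in>I. w i * c i) + K)"
      by simp
  qed
  then show "P \<in> dom_ereal (Fitzpatrick (sv_scale \<mu> (resolvent_average \<mu> I A w)))"
    unfolding dom_ereal_def by auto
qed

theorem theorem2p13:
  fixes A :: "nat \<Rightarrow> 'a::{real_inner, complete_space} \<Rightarrow> 'a set"
    and w :: "nat \<Rightarrow> real" and n :: nat and \<mu> :: real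
  assumes "\<mu> > 0"
    and "n \<ge> 1"
    and "\<And>i. i \<in> {1..n} \<Longrightarrow> w i > 0"
    and "(\<Sum>i\<in>{1..n}. w i) = 1"
    and "\<And>i. i \<in> {1..n} \<Longrightarrow> maximally_monotone (A i)"
  shows "(\<forall>p. Fitzpatrick (sv_scale \<mu> (resolvent_average \<mu> {1..n} A w)) p
            \<le> (\<Sum>i\<in>{1..n}. ereal (w i) * Fitzpatrick (sv_scale \<mu> (A i)) p))
       \<and> (\<forall>p. Fitzpatrick (resolvent_average 1 {1..n} A w) p
            \<le> (\<Sum>i\<in>{1..n}. ereal (w i) * Fitzpatrick (A i) p))
       \<and> (\<Sum>i\<in>{1..n}. (*\<^sub>R) (w i) ` dom_ereal (Fitzpatrick (sv_scale \<mu> (A i))))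
            \<subseteq> dom_ereal (Fitzpatrick (sv_scale \<mu> (resolvent_average \<mu> {1..n} A w)))
       \<and> (\<Sum>i\<in>{1..n}. (*\<^sub>R) (w i) ` dom_ereal (Fitzpatrick (A i)))
            \<subseteq> dom_ereal (Fitzpatrick (resolvent_average 1 {1..n} A w))"
proof -
  have w: "w i \<ge> 0" if "i \<in> {1..n}" for i
    using assms(3)[OF that] by simp
  note le = Fitzpatrick_scale_resolvent_average_le[OF finite_atLeastAtMost _ w assms(4), where A = A]
  note sub = sum_dom_Fitzpatrick_subset[OF finite_atLeastAtMost _ w assms(4), where A = A]
  show ?thesis
    using le[of \<mu>] sub[of \<mu>] le[of 1] sub[of 1] \<open>\<mu> > 0\<close> by (simp add: sv_scale_one)
qed

end
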